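(* Let $0<c_{\min}<c_{\max}<\infty$, $q:=\frac{c_{\max}-c_{\min}}{c_{\max}+c_{\min}}\in(0,1)$ and $\omega_0>0$. If $\phi>0$ is sufficiently small, then there is $\alpha_q\in(0,1)$ such that the following holds for all $n\ge1$, all $\omega\ge\omega_0$, and all widths $h_1,\dots,h_{n+1}>0$ with $\sum_{j=1}^{n+1}h_j=2$. Put $c_j=c_{\min}$ for odd $j$ and $c_j=c_{\max}$ for even $j$, and assume that $\phi_j:=-2\omega\frac{h_j}{c_j}\in[-\phi,0]$ for all $j$. Let $q_j=(-1)^{j+1}q$ and $\sigma_j=\mathrm{e}^{\mathrm{i}\phi_{j+1}}$, let $Q_1\in\mathbb{C}$ with $|Q_1|<1$, and set $$Q_j:=\frac{(-1)^{j+1}q+Q_{j-1}}{\sigma_j\left(1+(-1)^{j+1}qQ_{j-1}\right)},\qquad 2\le j\le n.$$ Then, for all $1\le j\le n$, $$|Q_j|^2\le 1-(1-|Q_1|^2)\,\alpha_q^{\omega/c_{\min}}.$$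
   Context: The $c_j$ are the values of a piecewise constant wave speed oscillating between $c_{\min}$ and $c_{\max}$ on the $n+1$ consecutive subintervals of $(-1,1)$ of lengths $h_j$, so that $q_j=\frac{c_{j+1}-c_j}{c_{j+1}+c_j}$; $\omega$ is the frequency, bounded below by a fixed $\omega_0>0$. *)

theory Defs
  imports Complex_Main
begin

definition layer_speed :: "real \<Rightarrow> real \<Rightarrow> nat \<Rightarrow> real" where
  "layer_speed c_min c_max j = (if odd j then c_min else c_max)"

definition contrast :: "real \<Rightarrow> real \<Rightarrow> real" where
  "contrast c_min c_max = (c_max - c_min) / (c_max + c_min)"

definition jump_coeff :: "real \<Rightarrow> real \<Rightarrow> nat \<Rightarrow> real" where
  "jump_coeff c_min c_max j = (-1) ^ (j + 1) * contrast c_min c_max"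

lemma jump_coeff_eq_relative_jump:
  "jump_coeff c_min c_max j =
     (layer_speed c_min c_max (j + 1) - layer_speed c_min c_max j) /
     (layer_speed c_min c_max (j + 1) + layer_speed c_min c_max j)"
  by (simp add: jump_coeff_def contrast_def layer_speed_def add.commute minus_divide_left del: minus_divide_left[symmetric])

definition layer_phase ::
    "real \<Rightarrow> real \<Rightarrow> real \<Rightarrow> (nat \<Rightarrow> real) \<Rightarrow> nat \<Rightarrow> real" where
  "layer_phase c_min c_max \<omega> h j = - 2 * \<omega> * (h j / layer_speed c_min c_max j)"

(* The phase factor at the j-th interface belongs to the layer to its right, hence j + 1. *)
definition phase_factor ::
    "real \<Rightarrow> real \<Rightarrow> real \<Rightarrow> (nat \<Rightarrow> real) \<Rightarrow> nat \<Rightarrow> complex" where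
  "phase_factor c_min c_max \<omega> h j = exp (\<i> * complex_of_real (layer_phase c_min c_max \<omega> h (j + 1)))"

end

theory Submission
  imports Defs
begin

text \<open>
  Each step \<open>Q\<^sub>j\<^sub>-\<^sub>1 \<mapsto> Q\<^sub>j\<close> is a hyperbolic translation \<open>B\<^sub>a\<close> of the unit disk with \<open>a = \<plusminus>q\<close>, followed by a
  rotation. Since \<open>B\<^sub>q\<close> and \<open>B\<^sub>-\<^sub>q\<close> are inverse to each other, a pair of consecutive steps is, up to
  rotation, the identity perturbed by a rotation of the angle \<open>\<phi>\<^sub>j\<^sub>+\<^sub>1\<close> between the two translations.
  Hence \<open>E(z) = (1 + |z|\<^sup>2) / (1 - |z|\<^sup>2)\<close>, evaluated at \<open>Q\<^sub>j\<close> for odd \<open>j\<close> and at \<open>B\<^sub>q(Q\<^sub>j)\<close> for even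
  \<open>j\<close>, grows by a factor of at most \<open>exp (C |\<phi>\<^sub>j\<^sub>+\<^sub>1|)\<close> per step, where \<open>C = 2q / (1 - q)\<^sup>2\<close>. The phases
  add up to at most \<open>4\<omega> / c_min\<close>, and the remaining constant factors are absorbed into \<open>\<alpha>\<close> because
  \<open>\<omega>\<close> is bounded below by \<open>\<omega>\<^sub>0\<close>.
\<close>

section \<open>Hyperbolic translations of the unit disk and the energy\<close>

definition disk_translation :: "real \<Rightarrow> complex \<Rightarrow> complex" where
  "disk_translation a z = (complex_of_real a + z) / (1 + complex_of_real a * z)"

text \<open>For \<open>z\<close> in the open unit disk this is \<open>cosh d\<close>, where
  \<open>d\<close> is the hyperbolic distance (curvature -1) from 0 to \<open>z\<close>.\<close>

definition disk_energy :: "complex \<Rightarrow> real" where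
  "disk_energy z = (1 + (cmod z)\<^sup>2) / (1 - (cmod z)\<^sup>2)"

lemma disk_translation_denominator_nonzero:
  assumes "\<bar>a\<bar> < 1" "cmod z < 1"
  shows "1 + complex_of_real a * z \<noteq> 0"
proof
  assume "1 + complex_of_real a * z = 0"
  then have "complex_of_real a * z = -1"
    by (simp add: add_eq_0_iff)
  then have "cmod (complex_of_real a * z) = 1"
    by simp
  then have "\<bar>a\<bar> * cmod z = 1"
    by (simp add: norm_mult)
  moreover have "\<bar>a\<bar> * cmod z \<le> \<bar>a\<bar> * 1"
    using assms by (intro mult_left_mono) auto
  ultimately show False
    using assms by simp
qed

lemma disk_translation_inverse:
  assumes "\<bar>a\<bar> < 1" "cmod z < 1"
  shows "disk_translation a (disk_translation (-a) z) = z"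
proof -
  have d: "1 - complex_of_real a * z \<noteq> 0"
    using disk_translation_denominator_nonzero[of "-a" z] assms by simp
  have "a\<^sup>2 < 1"
    using assms(1) by (simp add: abs_square_less_1)
  then have "complex_of_real (1 - a\<^sup>2) \<noteq> 0"
    by (metis diff_gt_0_iff_gt less_irrefl of_real_eq_0_iff)
  then have e: "1 - (complex_of_real a)\<^sup>2 \<noteq> 0"
    by simp
  \<comment> \<open>Numerator and denominator of the outer translation share the factor (1 - a^2) /
    (1 - a z), whose cancellation leaves \<open>z\<close>.\<close>
  have "complex_of_real a + (z - complex_of_real a) / (1 - complex_of_real a * z)
      = z * (1 - (complex_of_real a)\<^sup>2) / (1 - complex_of_real a * z)"
    using d by (simp add: field_simps power2_eq_square)
  moreover have "1 + complex_of_real a * ((z - complex_of_real a) / (1 - complex_of_real a * z))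
      = (1 - (complex_of_real a)\<^sup>2) / (1 - complex_of_real a * z)"
    using d by (simp add: field_simps power2_eq_square)
  ultimately show ?thesis
    using d e by (simp add: disk_translation_def)
qed

lemma norm_disk_translation:
  assumes "\<bar>a\<bar> < 1" "cmod z < 1"
  shows "1 - (cmod (disk_translation a z))\<^sup>2
    = (1 - a\<^sup>2) * (1 - (cmod z)\<^sup>2) / (cmod (1 + complex_of_real a * z))\<^sup>2"
proof -
  have "(cmod (1 + complex_of_real a * z))\<^sup>2 \<noteq> 0"
    using disk_translation_denominator_nonzero[OF assms] by simp
  moreover have "(cmod (1 + complex_of_real a * z))\<^sup>2 - (cmod (complex_of_real a + z))\<^sup>2
      = (1 - a\<^sup>2) * (1 - (cmod z)\<^sup>2)"
    unfolding cmod_power2 by (simp add: power2_eq_square algebra_simps)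
  ultimately show ?thesis
    by (simp add: disk_translation_def norm_divide power_divide field_simps)
qed

lemma norm_disk_translation_less_1:
  assumes "\<bar>a\<bar> < 1" "cmod z < 1"
  shows "cmod (disk_translation a z) < 1"
proof -
  have "0 < 1 - (cmod (disk_translation a z))\<^sup>2"
    unfolding norm_disk_translation[OF assms]
    using assms disk_translation_denominator_nonzero[OF assms]
    by (intro divide_pos_pos mult_pos_pos) (simp_all add: abs_square_less_1)
  then show ?thesis
    by (simp add: abs_square_less_1)
qed

text \<open>Numerator and denominator of the energy both carry |1 + a z|^-2, which cancels. In what
  remains, the argument of \<open>z\<close> enters only through the term
  \<open>4 * a * Re z\<close>, so the effect of a rotation can be read off.\<close>

lemma disk_energy_translation:
  assumes "\<bar>a\<bar> < 1" "cmod z < 1"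
  shows "disk_energy (disk_translation a z)
    = ((1 + a\<^sup>2) * (1 + (cmod z)\<^sup>2) + 4 * a * Re z) / ((1 - a\<^sup>2) * (1 - (cmod z)\<^sup>2))"
proof -
  define D where "D = (cmod (1 + complex_of_real a * z))\<^sup>2"
  have D: "D \<noteq> 0"
    unfolding D_def using disk_translation_denominator_nonzero[OF assms] by simp
  have "D * (1 + (cmod (disk_translation a z))\<^sup>2) = D + (cmod (complex_of_real a + z))\<^sup>2"
    using D by (simp add: D_def disk_translation_def norm_divide power_divide field_simps)
  also have "\<dots> = (1 + a\<^sup>2) * (1 + (cmod z)\<^sup>2) + 4 * a * Re z"
    unfolding D_def cmod_power2 by (simp add: power2_eq_square algebra_simps)
  finally have "1 + (cmod (disk_translation a z))\<^sup>2
      = ((1 + a\<^sup>2) * (1 + (cmod z)\<^sup>2) + 4 * a * Re z) / D"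
    using D by (simp add: field_simps)
  then show ?thesis
    using D by (simp add: disk_energy_def norm_disk_translation[OF assms] flip: D_def)
qed

text \<open>The difference of the two sides is 2 a |1 + w|^2.\<close>

lemma energy_numerator_ge:
  assumes "0 \<le> a"
  shows "(1 - a)\<^sup>2 * (1 + (cmod w)\<^sup>2) \<le> (1 + a\<^sup>2) * (1 + (cmod w)\<^sup>2) + 4 * a * Re w"
proof -
  have "0 \<le> (1 + Re w)\<^sup>2 + (Im w)\<^sup>2"
    by simp
  then have "0 \<le> 2 * a * ((1 + Re w)\<^sup>2 + (Im w)\<^sup>2)"
    using assms by (intro mult_nonneg_nonneg) auto
  then show ?thesis
    unfolding cmod_power2 by (simp add: power2_eq_square algebra_simps)
qed

section \<open>Rotations and comparison of energies\<close>

lemma norm_cis_minus_1_le: "cmod (cis t - 1) \<le> \<bar>t\<bar>"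
proof -
  have "(cmod (cis t - 1))\<^sup>2 = (cos t)\<^sup>2 + (sin t)\<^sup>2 + 1 - 2 * cos t"
    unfolding cmod_power2 by (simp add: power2_diff)
  also have "\<dots> = 2 - 2 * cos (2 * (t / 2))"
    by simp
  also have "\<dots> = (2 * sin (t / 2))\<^sup>2"
    unfolding cos_double_sin power_mult_distrib by simp
  also have "\<dots> \<le> \<bar>t\<bar>\<^sup>2"
    using abs_sin_x_le_abs_x[of "t / 2"] unfolding abs_le_square_iff[symmetric] power2_abs by simp
  finally show ?thesis
    by (rule power2_le_imp_le) simp
qed

text \<open>The denominator depends only on |w|. The numerator grows by at most 4 a |t| |w|, hence
  by at most 2 a |t| (1 + |w|^2), and \<open>energy_numerator_ge\<close> turns this into a multiple
  of the numerator itself. The bound is therefore relative and uniform up to the boundary of the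
  disk.\<close>

lemma disk_energy_translation_rotation:
  assumes a: "0 \<le> a" "a < 1" and w: "cmod w < 1"
  shows "disk_energy (disk_translation a (cis t * w))
    \<le> exp (2 * a / (1 - a)\<^sup>2 * \<bar>t\<bar>) * disk_energy (disk_translation a w)"
proof -
  define N where "N z = (1 + a\<^sup>2) * (1 + (cmod z)\<^sup>2) + 4 * a * Re z" for z
  define c where "c = 2 * a / (1 - a)\<^sup>2"
  have rot: "cmod (cis t * w) = cmod w"
    by (simp add: norm_mult)
  have den: "0 < (1 - a\<^sup>2) * (1 - (cmod w)\<^sup>2)"
    using a w by (intro mult_pos_pos) (simp_all add: abs_square_less_1)
  have Nge: "(1 - a)\<^sup>2 * (1 + (cmod w)\<^sup>2) \<le> N w"
    unfolding N_def by (rule energy_numerator_ge[OF a(1)])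
  have Npos: "0 \<le> N w"
    by (rule order_trans[OF _ Nge]) simp
  have "Re (cis t * w) - Re w = Re ((cis t - 1) * w)"
    by (simp add: algebra_simps)
  also have "\<dots> \<le> cmod ((cis t - 1) * w)"
    by (rule complex_Re_le_cmod)
  also have "\<dots> \<le> \<bar>t\<bar> * cmod w"
    unfolding norm_mult by (intro mult_right_mono norm_cis_minus_1_le) simp
  finally have "4 * a * (Re (cis t * w) - Re w) \<le> 4 * a * (\<bar>t\<bar> * cmod w)"
    using a by (intro mult_left_mono) auto
  also have "\<dots> = 2 * a * \<bar>t\<bar> * (2 * cmod w)"
    by simp
  also have "\<dots> \<le> 2 * a * \<bar>t\<bar> * (1 + (cmod w)\<^sup>2)"
    using a sum_squares_bound[of 1 "cmod w"] by (intro mult_left_mono) auto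
  also have "\<dots> = c * \<bar>t\<bar> * ((1 - a)\<^sup>2 * (1 + (cmod w)\<^sup>2))"
    using a by (simp add: c_def)
  also have "\<dots> \<le> c * \<bar>t\<bar> * N w"
    using a by (intro mult_left_mono Nge) (simp add: c_def)
  finally have "N (cis t * w) \<le> (1 + c * \<bar>t\<bar>) * N w"
    unfolding N_def rot by (simp add: algebra_simps)
  also have "\<dots> \<le> exp (c * \<bar>t\<bar>) * N w"
    using Npos by (intro mult_right_mono exp_ge_add_one_self)
  finally have "N (cis t * w) / ((1 - a\<^sup>2) * (1 - (cmod w)\<^sup>2))
      \<le> exp (c * \<bar>t\<bar>) * N w / ((1 - a\<^sup>2) * (1 - (cmod w)\<^sup>2))"
    using den by (intro divide_right_mono) simp_all
  moreover have "disk_energy (disk_translation a z) = N z / ((1 - a\<^sup>2) * (1 - (cmod z)\<^sup>2))"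
    if "cmod z < 1" for z
    unfolding N_def using a that by (simp add: disk_energy_translation)
  ultimately show ?thesis
    unfolding c_def using w rot by simp
qed

text \<open>Recovers the energy of \<open>w\<close> from that of its translate; the factor is (1 -
  a)^2 / (1 - a^2).\<close>

lemma disk_energy_translation_ge:
  assumes a: "0 \<le> a" "a < 1" and w: "cmod w < 1"
  shows "(1 - a) / (1 + a) * disk_energy w \<le> disk_energy (disk_translation a w)"
proof -
  have den: "0 < (1 - a\<^sup>2) * (1 - (cmod w)\<^sup>2)"
    using a w by (intro mult_pos_pos) (simp_all add: abs_square_less_1)
  have "1 - a\<^sup>2 = (1 - a) * (1 + a)"
    by (simp add: power2_eq_square algebra_simps)
  then have "(1 - a) / (1 + a) * disk_energy w
      = (1 - a)\<^sup>2 * (1 + (cmod w)\<^sup>2) / ((1 - a\<^sup>2) * (1 - (cmod w)\<^sup>2))"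
    using a by (simp add: disk_energy_def power2_eq_square)
  also have "\<dots> \<le> ((1 + a\<^sup>2) * (1 + (cmod w)\<^sup>2) + 4 * a * Re w)
      / ((1 - a\<^sup>2) * (1 - (cmod w)\<^sup>2))"
    using den by (intro divide_right_mono energy_numerator_ge a) simp
  also have "\<dots> = disk_energy (disk_translation a w)"
    using a w by (simp add: disk_energy_translation)
  finally show ?thesis .
qed

lemma disk_energy_cis_mult: "disk_energy (cis t * w) = disk_energy w"
  by (simp add: disk_energy_def norm_mult)

section \<open>Energy growth along the alternating recursion\<close>

lemma alternating_translations_energy:
  assumes q: "0 \<le> q" "q < 1" and Q1: "cmod (Q 1) < 1"
    and rec: "\<And>j. j \<in> {2..n} \<Longrightarrow>
      Q j = cis (\<theta> j) * disk_translation ((-1) ^ (j + 1) * q) (Q (j - 1))"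
    and j: "1 \<le> j" "j \<le> n"
  shows "cmod (Q j) < 1 \<and>
    disk_energy (if odd j then Q j else disk_translation q (Q j))
      \<le> exp (2 * q / (1 - q)\<^sup>2 * (\<Sum>i=2..j. \<bar>\<theta> i\<bar>)) * disk_energy (Q 1)"
  using j
proof (induction j rule: dec_induct)
  case base
  then show ?case
    using Q1 by simp
next
  case (step m)
  define c where "c = 2 * q / (1 - q)\<^sup>2"
  define S where "S = (\<Sum>i=2..m. \<bar>\<theta> i\<bar>)"
  define t where "t = \<theta> (Suc m)"
  have c: "0 \<le> c"
    using q by (simp add: c_def)
  have E1: "0 \<le> disk_energy (Q 1)"
    using Q1 by (simp add: disk_energy_def abs_square_less_1 less_imp_le)
  have Qm: "cmod (Q m) < 1"
    and IH: "disk_energy (if odd m then Q m else disk_translation q (Q m))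
      \<le> exp (c * S) * disk_energy (Q 1)"
    using step by (auto simp: c_def S_def)
  have Q: "Q (Suc m) = cis t * disk_translation ((-1) ^ m * q) (Q m)"
    using rec[of "Suc m"] step by (simp add: t_def)
  have "\<bar>(-1) ^ m * q\<bar> < 1"
    using q by (simp add: abs_mult)
  then have T: "cmod (disk_translation ((-1) ^ m * q) (Q m)) < 1"
    using Qm by (rule norm_disk_translation_less_1)
  then have Q': "cmod (Q (Suc m)) < 1"
    by (simp add: Q norm_mult)
  have "disk_energy (if odd (Suc m) then Q (Suc m) else disk_translation q (Q (Suc m)))
      \<le> exp (c * \<bar>t\<bar>) * disk_energy (if odd m then Q m else disk_translation q (Q m))"
  proof (cases "even m")
    \<comment> \<open>The step applies the translation by \<open>q\<close> that the energy at an
      even index already contains. The rotation after it preserves the energy, so nothing is lost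
      and the exponential factor is slack.\<close>
    case True
    have "0 \<le> disk_energy (disk_translation q (Q m))"
      using T True by (simp add: disk_energy_def abs_square_less_1 less_imp_le)
    then show ?thesis
      using True c by (simp add: Q disk_energy_cis_mult mult_le_cancel_right1)
  next
    \<comment> \<open>The step translates by \<open>-q\<close>, and the energy at the new even index
      translates back by \<open>q\<close>. Only the rotation by \<open>t\<close> in between keeps
      the two from cancelling.\<close>
    case False
    then show ?thesis
      using disk_energy_translation_rotation[OF q, of "disk_translation (-q) (Q m)" t] T q Qm
      by (simp add: Q disk_translation_inverse c_def)
  qed
  also have "\<dots> \<le> exp (c * \<bar>t\<bar>) * (exp (c * S) * disk_energy (Q 1))"
    using IH by (rule mult_left_mono) simp
  also have "\<dots> = exp (c * (S + \<bar>t\<bar>)) * disk_energy (Q 1)"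
    by (simp add: exp_add[symmetric] algebra_simps)
  also have "S + \<bar>t\<bar> = (\<Sum>i=2..Suc m. \<bar>\<theta> i\<bar>)"
    using step by (simp add: S_def t_def)
  finally show ?case
    using Q' by (simp add: c_def)
qed

text \<open>In the disk the energy lies between 1 / (1 - |z|^2) and 2 / (1 - |z|^2), which costs the
  factor 2. The factor (1 - q) / (1 + q) is the price of removing the extra translation at even
  \<open>j\<close>.\<close>

lemma alternating_translations_norm_bound:
  assumes q: "0 \<le> q" "q < 1" and Q1: "cmod (Q 1) < 1"
    and rec: "\<And>j. j \<in> {2..n} \<Longrightarrow>
      Q j = cis (\<theta> j) * disk_translation ((-1) ^ (j + 1) * q) (Q (j - 1))"
    and j: "1 \<le> j" "j \<le> n" and S: "(\<Sum>i=2..n. \<bar>\<theta> i\<bar>) \<le> S"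
  shows "(1 - (cmod (Q 1))\<^sup>2) * ((1 - q) / (2 * (1 + q)) * exp (- (2 * q / (1 - q)\<^sup>2 * S)))
    \<le> 1 - (cmod (Q j))\<^sup>2"
proof -
  define c where "c = 2 * q / (1 - q)\<^sup>2"
  define k where "k = (1 - q) / (1 + q)"
  have c: "0 \<le> c" and k: "0 < k" "k \<le> 1"
    using q by (simp_all add: c_def k_def)
  have Qj: "cmod (Q j) < 1" and E: "disk_energy (if odd j then Q j else disk_translation q (Q j))
      \<le> exp (c * (\<Sum>i=2..j. \<bar>\<theta> i\<bar>)) * disk_energy (Q 1)"
    using alternating_translations_energy[OF q Q1 rec j] by (simp_all add: c_def)
  have pos: "0 < 1 - (cmod (Q j))\<^sup>2" "0 < 1 - (cmod (Q 1))\<^sup>2"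
    using Qj Q1 by (simp_all add: abs_square_less_1)
  have "(\<Sum>i=2..j. \<bar>\<theta> i\<bar>) \<le> (\<Sum>i=2..n. \<bar>\<theta> i\<bar>)"
    using j by (intro sum_mono2) auto
  then have sum: "(\<Sum>i=2..j. \<bar>\<theta> i\<bar>) \<le> S"
    using S by simp
  \<comment> \<open>Since \<open>k\<close> is at most 1, the same lower bound serves both
    parities.\<close>
  have "k * (1 / (1 - (cmod (Q j))\<^sup>2)) \<le> k * disk_energy (Q j)"
    using k pos by (intro mult_left_mono) (simp_all add: disk_energy_def divide_right_mono)
  also have "\<dots> \<le> disk_energy (if odd j then Q j else disk_translation q (Q j))"
  proof (cases "odd j")
    case True
    have "0 \<le> disk_energy (Q j)"
      using pos by (simp add: disk_energy_def)
    then show ?thesis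
      using True k by (simp add: mult_left_le_one_le)
  next
    case False
    then show ?thesis
      using disk_energy_translation_ge[OF q Qj] by (simp add: k_def)
  qed
  also note E
  also have "exp (c * (\<Sum>i=2..j. \<bar>\<theta> i\<bar>)) * disk_energy (Q 1)
      \<le> exp (c * S) * (2 / (1 - (cmod (Q 1))\<^sup>2))"
    using pos c sum
    by (intro mult_mono) (auto simp: disk_energy_def intro!: divide_right_mono mult_left_mono)
  finally have "k * (1 - (cmod (Q 1))\<^sup>2) \<le> 2 * exp (c * S) * (1 - (cmod (Q j))\<^sup>2)"
    using pos by (simp add: field_simps)
  then have "(1 - (cmod (Q 1))\<^sup>2) * (k / 2 * exp (- (c * S))) \<le> 1 - (cmod (Q j))\<^sup>2"
    by (simp add: exp_minus field_simps)
  moreover have "k / 2 = (1 - q) / (2 * (1 + q))"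
    by (simp add: k_def)
  ultimately show ?thesis
    by (simp only: c_def)
qed

section \<open>Total phase and choice of the base\<close>

lemma sum_layer_phase_le:
  assumes c: "0 < c_min" "c_min < c_max" and \<omega>: "0 \<le> \<omega>"
    and h: "\<And>j. j \<in> {1..n + 1} \<Longrightarrow> 0 < h j" and sum: "(\<Sum>j=1..n+1. h j) = 2"
  shows "(\<Sum>j=2..n. \<bar>layer_phase c_min c_max \<omega> h (j + 1)\<bar>) \<le> 4 * (\<omega> / c_min)"
proof -
  \<comment> \<open>The interfaces 2 to \<open>n\<close> see the layers 3 to \<open>n + 1\<close>;
    adding the first two layers makes the total width 2 available.\<close>
  have "(\<Sum>j=2..n. \<bar>layer_phase c_min c_max \<omega> h (j + 1)\<bar>)
      = (\<Sum>j=3..n+1. \<bar>layer_phase c_min c_max \<omega> h j\<bar>)"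
    using sum.shift_bounds_cl_nat_ivl[of "\<lambda>j. \<bar>layer_phase c_min c_max \<omega> h j\<bar>" 2 1 n]
    by (simp add: numeral_3_eq_3)
  also have "\<dots> \<le> (\<Sum>j=1..n+1. \<bar>layer_phase c_min c_max \<omega> h j\<bar>)"
    by (rule sum_mono2) auto
  also have "\<dots> \<le> (\<Sum>j=1..n+1. 2 * (\<omega> / c_min) * h j)"
  proof (rule sum_mono)
    fix j assume "j \<in> {1..n+1}"
    then have hj: "0 < h j"
      by (rule h)
    define s where "s = layer_speed c_min c_max j"
    have s: "c_min \<le> s"
      using c by (simp add: s_def layer_speed_def)
    have "h j / s \<le> h j / c_min"
      using s hj c by (intro divide_left_mono mult_pos_pos) auto
    then have "2 * \<omega> * (h j / s) \<le> 2 * \<omega> * (h j / c_min)"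
      using \<omega> by (intro mult_left_mono) auto
    moreover have "\<bar>layer_phase c_min c_max \<omega> h j\<bar> = 2 * \<omega> * (h j / s)"
      using s hj c \<omega> by (simp add: layer_phase_def abs_mult flip: s_def)
    ultimately show "\<bar>layer_phase c_min c_max \<omega> h j\<bar> \<le> 2 * (\<omega> / c_min) * h j"
      by simp
  qed
  also have "\<dots> = 4 * (\<omega> / c_min)"
    unfolding sum_distrib_left[symmetric] sum by simp
  finally show ?thesis .
qed

theorem proposition19:
  fixes c_min c_max \<omega>\<^sub>0 :: real
  assumes "0 < c_min" and "c_min < c_max" and "0 < \<omega>\<^sub>0"
  shows "\<exists>\<phi>\<^sub>0>0. \<forall>\<phi>::real. 0 < \<phi> \<and> \<phi> \<le> \<phi>\<^sub>0 \<longrightarrow>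
    (\<exists>\<alpha>::real. 0 < \<alpha> \<and> \<alpha> < 1 \<and>
      (\<forall>(n::nat) (\<omega>::real) (h::nat \<Rightarrow> real) (Q::nat \<Rightarrow> complex).
         1 \<le> n \<longrightarrow> \<omega>\<^sub>0 \<le> \<omega> \<longrightarrow>
         (\<forall>j\<in>{1..n+1}. 0 < h j) \<longrightarrow> (\<Sum>j=1..n+1. h j) = 2 \<longrightarrow>
         (\<forall>j\<in>{1..n+1}. layer_phase c_min c_max \<omega> h j \<in> {-\<phi>..0}) \<longrightarrow>
         cmod (Q 1) < 1 \<longrightarrow>
         (\<forall>j\<in>{2..n}. Q j =
            (complex_of_real (jump_coeff c_min c_max j) + Q (j - 1)) /
            (phase_factor c_min c_max \<omega> h j *
              (1 + complex_of_real (jump_coeff c_min c_max j) * Q (j - 1)))) \<longrightarrow>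
         (\<forall>j\<in>{1..n}. (cmod (Q j))\<^sup>2 \<le>
            1 - (1 - (cmod (Q 1))\<^sup>2) * \<alpha> powr (\<omega> / c_min))))"
proof -
  define q where "q = contrast c_min c_max"
  have q: "0 \<le> q" "q < 1"
    using assms by (simp_all add: q_def contrast_def)
  define C where "C = 2 * q / (1 - q)\<^sup>2"
  define L where "L = ln (2 * (1 + q) / (1 - q))"
  \<comment> \<open>Raised to the power \<omega> / \<open>c_min\<close>, the part
    \<open>4 * C\<close> pays for the total phase. The other part gives exp (- L \<omega> /
    \<open>\<omega>\<^sub>0\<close>), at most exp (- L), which is the constant (1 - q) / (2 (1 +
    q)).\<close>
  define \<alpha> where "\<alpha> = exp (- (4 * C + L * c_min / \<omega>\<^sub>0))"
  have C: "0 \<le> C"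
    using q by (simp add: C_def)
  have L: "0 < L"
    unfolding L_def using q by (intro ln_gt_zero) (simp add: field_simps)
  have \<alpha>: "0 < \<alpha>" "\<alpha> < 1"
  proof -
    have "0 < L * c_min / \<omega>\<^sub>0"
      using L assms by simp
    then have "0 < 4 * C + L * c_min / \<omega>\<^sub>0"
      using C by linarith
    then show "0 < \<alpha>" "\<alpha> < 1"
      unfolding \<alpha>_def by simp_all
  qed
  have \<alpha>_powr: "\<alpha> powr (\<omega> / c_min) \<le> (1 - q) / (2 * (1 + q)) * exp (- (C * (4 * (\<omega> / c_min))))"
    if "\<omega>\<^sub>0 \<le> \<omega>" for \<omega>
  proof -
    have "L * 1 \<le> L * (\<omega> / \<omega>\<^sub>0)"
      using that L assms by (intro mult_left_mono) auto
    moreover have "\<omega> / c_min * (4 * C + L * c_min / \<omega>\<^sub>0) = C * (4 * (\<omega> / c_min)) + L * (\<omega> / \<omega>\<^sub>0)"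
      using assms by (simp add: distrib_left mult.commute)
    ultimately have "L + C * (4 * (\<omega> / c_min)) \<le> \<omega> / c_min * (4 * C + L * c_min / \<omega>\<^sub>0)"
      by linarith
    then have "\<omega> / c_min * - (4 * C + L * c_min / \<omega>\<^sub>0) \<le> - L - C * (4 * (\<omega> / c_min))"
      by linarith
    then have "\<alpha> powr (\<omega> / c_min) \<le> exp (- L - C * (4 * (\<omega> / c_min)))"
      unfolding \<alpha>_def powr_def by simp
    also have "\<dots> = exp (- L) * exp (- (C * (4 * (\<omega> / c_min))))"
      by (simp flip: exp_add)
    also have "exp (- L) = (1 - q) / (2 * (1 + q))"
      using q by (simp add: L_def exp_minus)
    finally show ?thesis .
  qed
  have bound: "(cmod (Q j))\<^sup>2 \<le> 1 - (1 - (cmod (Q 1))\<^sup>2) * \<alpha> powr (\<omega> / c_min)"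
    if \<omega>: "\<omega>\<^sub>0 \<le> \<omega>" and h: "\<forall>j\<in>{1..n+1}. 0 < h j" and sum: "(\<Sum>j=1..n+1. h j) = 2"
      and Q1: "cmod (Q 1) < 1"
      and rec: "\<forall>j\<in>{2..n}. Q j =
            (complex_of_real (jump_coeff c_min c_max j) + Q (j - 1)) /
            (phase_factor c_min c_max \<omega> h j *
              (1 + complex_of_real (jump_coeff c_min c_max j) * Q (j - 1)))"
      and j: "j \<in> {1..n}"
    for n \<omega> h Q j
  proof -
    \<comment> \<open>The phase factor stands in the denominator, hence the minus sign; it belongs
      to the layer right of interface \<open>j\<close>, hence \<open>j + 1\<close>.\<close>
    define \<theta> where "\<theta> j = - layer_phase c_min c_max \<omega> h (j + 1)" for j
    have rec': "Q j = cis (\<theta> j) * disk_translation ((-1) ^ (j + 1) * q) (Q (j - 1))"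
      if "j \<in> {2..n}" for j
    proof -
      have "inverse (phase_factor c_min c_max \<omega> h j) = cis (\<theta> j)"
        by (simp add: phase_factor_def \<theta>_def cis_conv_exp flip: exp_minus)
      then show ?thesis
        using rec[rule_format, OF that]
        by (simp add: disk_translation_def jump_coeff_def q_def divide_inverse mult.assoc mult.left_commute)
    qed
    have "(\<Sum>i=2..n. \<bar>\<theta> i\<bar>) \<le> 4 * (\<omega> / c_min)"
      using sum_layer_phase_le[of c_min c_max \<omega> n h] assms \<omega> h sum by (simp add: \<theta>_def)
    then have "(1 - (cmod (Q 1))\<^sup>2) * ((1 - q) / (2 * (1 + q)) * exp (- (C * (4 * (\<omega> / c_min)))))
        \<le> 1 - (cmod (Q j))\<^sup>2"
      unfolding C_def using j
      by (intro alternating_translations_norm_bound[where \<theta> = \<theta> and n = n, OF q Q1 rec']) auto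
    moreover have "(1 - (cmod (Q 1))\<^sup>2) * \<alpha> powr (\<omega> / c_min) \<le> (1 - (cmod (Q 1))\<^sup>2) *
        ((1 - q) / (2 * (1 + q)) * exp (- (C * (4 * (\<omega> / c_min)))))"
      using Q1 by (intro mult_left_mono \<alpha>_powr \<omega>) (simp add: abs_square_le_1)
    ultimately show ?thesis
      by linarith
  qed
  show ?thesis
    by (rule exI[of _ 1], intro conjI zero_less_one allI impI ballI exI[of _ \<alpha>])
      (rule \<alpha>(1), rule \<alpha>(2), rule bound, assumption+)
qed

end
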